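(* Let $n,N$ be integers with $3\le n+1\le N$. (a) If $(S,w)$ is a non-trivial extreme ray of $P_{N,n}$, then $S\in H_{N,n}$. (b) If $S$ is an extreme ray of $H_{N,n}$, then there is a weight vector $w$ such that $(S,w)$ is a non-trivial extreme ray of $P_{N,n}$.
   Context: For a positive integer $k$ let $[k]=\{1,\dots,k\}$. $K_N$ is the undirected complete graph on vertex set $[N]$, with edge set $E_N=\{(i,j):1\le i<j\le N\}$. For a vector $w=(w(e))_{e\in E_N}$ and $W\subseteq[N]$, the cut $C(W)$ is the set of edges with exactly one endpoint in $W$, and $\|C(W)\|=\sum_{e\in C(W)}w(e)$. A nonnegative $w$ on $K_N$ realizes in $K_N$ the vector $S=(S_I)_{\varnothing\ne I\subseteq[n]}\in\mathbb{R}^{2^n-1}$ with $S_I=\min\{\|C(W)\| : W\subseteq[N-1],\ W\cap[n]=I\}$. $H_{N,n}$ is the convex hull of all $S\in\mathbb{R}^{2^n-1}$ realized by some nonnegative $w$ in $K_N$; it is a cone. $P_{N,n}$ is the cone of all $(S,w)\in\mathbb{R}^{2^n-1}\times\mathbb{R}^{E_N}$ (with $S$ and $w$ both variables) satisfying $$S_I\le\|C(W)\|\quad\text{for all } W\subseteq[N-1],\ \varnothing\ne I\subseteq[n]\text{ with } I=W\cap[n],\qquad w(e)\ge 0\quad\text{for all } e\in E_N.$$ Extreme rays are identified with their nonzero generating vectors up to positive scaling. An extreme ray of $P_{N,n}$ is called trivial if (up to positive scaling) it has either exactly one $S_I=-1$ and all other coordinates zero, or exactly one $w(e)=1$ and all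 other coordinates zero; otherwise it is non-trivial. *)

theory Defs
  imports "HOL-Analysis.Analysis" "HOL-Analysis.Finite_Function_Topology"
begin

text \<open>
  Coordinate spaces indexed by a finite set \<open>A\<close> that depends on numerical parameters are
  represented as the finitely supported functions whose support lies in \<open>A\<close>. Finitely supported
  functions form a real vector space, so that hulls and faces are those of the library.
\<close>

definition coord_space :: "'a set \<Rightarrow> ('a \<Rightarrow>\<^sub>0 real) set" where
  "coord_space A = {v. Poly_Mapping.keys v \<subseteq> A}"

definition terminal_sets :: "nat \<Rightarrow> nat set set" where
  "terminal_sets n = {I. I \<noteq> {} \<and> I \<subseteq> {1..n}}"

definition edges :: "nat \<Rightarrow> (nat \<times> nat) set" where
  "edges N = {(i, j). 1 \<le> i \<and> i < j \<and> j \<le> N}"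

definition cut :: "nat \<Rightarrow> nat set \<Rightarrow> (nat \<times> nat) set" where
  "cut N W = {(i, j) \<in> edges N. card ({i, j} \<inter> W) = 1}"

definition cut_weight :: "nat \<Rightarrow> (nat \<times> nat \<Rightarrow>\<^sub>0 real) \<Rightarrow> nat set \<Rightarrow> real" where
  "cut_weight N w W = (\<Sum>e\<in>cut N W. Poly_Mapping.lookup w e)"

definition realizes ::
  "nat \<Rightarrow> nat \<Rightarrow> (nat \<times> nat \<Rightarrow>\<^sub>0 real) \<Rightarrow> (nat set \<Rightarrow>\<^sub>0 real) \<Rightarrow> bool" where
  "realizes N n w S \<longleftrightarrow>
     w \<in> coord_space (edges N) \<and> (\<forall>e\<in>edges N. 0 \<le> Poly_Mapping.lookup w e) \<and>
     S \<in> coord_space (terminal_sets n) \<and>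
     (\<forall>I\<in>terminal_sets n.
        Poly_Mapping.lookup S I = Min {cut_weight N w W |W. W \<subseteq> {1..N - 1} \<and> W \<inter> {1..n} = I})"

definition H_cone :: "nat \<Rightarrow> nat \<Rightarrow> (nat set \<Rightarrow>\<^sub>0 real) set" where
  "H_cone N n = convex hull {S. \<exists>w. realizes N n w S}"

definition P_cone :: "nat \<Rightarrow> nat \<Rightarrow> ((nat set \<Rightarrow>\<^sub>0 real) \<times> (nat \<times> nat \<Rightarrow>\<^sub>0 real)) set" where
  "P_cone N n =
     {(S, w). S \<in> coord_space (terminal_sets n) \<and> w \<in> coord_space (edges N) \<and>
        (\<forall>W I. W \<subseteq> {1..N - 1} \<longrightarrow> I \<in> terminal_sets n \<longrightarrow> I = W \<inter> {1..n} \<longrightarrow>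
           Poly_Mapping.lookup S I \<le> cut_weight N w W) \<and>
        (\<forall>e\<in>edges N. 0 \<le> Poly_Mapping.lookup w e)}"

text \<open>
  An extreme ray is a face that is a half-line from the origin, and is named by a nonzero
  generator; \<open>cone hull {x}\<close> is the set of nonnegative multiples of \<open>x\<close>.
\<close>

definition extreme_ray :: "'a::real_vector \<Rightarrow> 'a set \<Rightarrow> bool" where
  "extreme_ray x C \<longleftrightarrow> x \<noteq> 0 \<and> (cone hull {x}) face_of C"

definition trivial_ray ::
  "nat \<Rightarrow> nat \<Rightarrow> (nat set \<Rightarrow>\<^sub>0 real) \<times> (nat \<times> nat \<Rightarrow>\<^sub>0 real) \<Rightarrow> bool" where
  "trivial_ray N n x \<longleftrightarrow>
     (\<exists>c>0. (\<exists>I\<in>terminal_sets n. x = c *\<^sub>R (Poly_Mapping.single I (- 1), 0)) \<or>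
            (\<exists>e\<in>edges N. x = c *\<^sub>R (0, Poly_Mapping.single e 1)))"

definition nontrivial_extreme_ray ::
  "nat \<Rightarrow> nat \<Rightarrow> (nat set \<Rightarrow>\<^sub>0 real) \<times> (nat \<times> nat \<Rightarrow>\<^sub>0 real) \<Rightarrow> bool" where
  "nontrivial_extreme_ray N n x \<longleftrightarrow> extreme_ray x (P_cone N n) \<and> \<not> trivial_ray N n x"

end

theory Submission
  imports Defs
begin

text \<open>
  If \<open>(S, w)\<close> is a non-trivial extreme ray, no single coordinate of \<open>S\<close> can be increased, since
  otherwise a trivial ray would split off; hence \<open>S\<close> is the vector of minimum cuts of \<open>w\<close>.
  Conversely, an extreme ray \<open>S\<close> of the hull is realized by some \<open>w\<close>, and among the realizing
  weights one takes one for which the number of tight inequalities is largest. The summands of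
  any decomposition of \<open>(S, w)\<close> inherit its tight inequalities, so they are realizations themselves
  and their first components are multiples \<open>c S\<close>. If a second component differed from \<open>c w\<close>, moving
  \<open>w\<close> along the difference would keep the tight inequalities tight and make a further one tight.
\<close>

section \<open>Faces and extreme rays of cones, and a ratio test\<close>

lemma mem_cone_hull_singleton: "y \<in> cone hull {x} \<longleftrightarrow> (\<exists>c\<ge>0. y = c *\<^sub>R x)"
  by (auto simp: cone_hull_expl)

text \<open>The sum \<open>a + b\<close> is the midpoint of \<open>2 *\<^sub>R a\<close> and
  \<open>2 *\<^sub>R b\<close>, so the face property applies to that segment. If
  \<open>a = b\<close> the open segment is empty and scaling by one half is used instead.\<close>

lemma face_of_cone_summand:
  assumes F: "F face_of C" and F': "cone F" and C: "cone C"
    and a: "a \<in> C" and b: "b \<in> C" and ab: "a + b \<in> F"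
  shows "a \<in> F"
proof (cases "a = b")
  case True
  have "(1/2) *\<^sub>R (a + b) \<in> F"
    using F' ab by (intro mem_cone) auto
  moreover have "(1/2) *\<^sub>R (a + b) = a"
    using True by (simp add: scaleR_2 [symmetric])
  ultimately show ?thesis by simp
next
  case False
  have "2 *\<^sub>R a \<in> C" "2 *\<^sub>R b \<in> C"
    using a b C by (auto intro: mem_cone)
  moreover have "a + b \<in> open_segment (2 *\<^sub>R a) (2 *\<^sub>R b)"
    using False by (auto simp: in_segment intro!: exI[of _ "1/2"])
  ultimately have "2 *\<^sub>R a \<in> F"
    using F ab unfolding face_of_def by blast
  from mem_cone[OF F' this, of "1/2"] have "(1/2) *\<^sub>R (2 *\<^sub>R a) \<in> F"
    by simp
  then show ?thesis by simp
qed

text \<open>In a cone the weights of a convex combination can be absorbed into its points, so the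
  face condition reduces to sums. By symmetry it is enough to control the first summand.\<close>

lemma extreme_rayI:
  assumes x: "x \<noteq> 0" "x \<in> C" and C: "cone C"
    and sum: "\<And>a b k. \<lbrakk>a \<in> C; b \<in> C; 0 \<le> k; a + b = k *\<^sub>R x\<rbrakk> \<Longrightarrow> a \<in> cone hull {x}"
  shows "extreme_ray x C"
proof -
  have summand: "a \<in> cone hull {x}"
    if "a \<in> C" "b \<in> C" "0 < s" "0 < t" "s *\<^sub>R a + t *\<^sub>R b \<in> cone hull {x}" for a b s t
  proof -
    have "s *\<^sub>R a \<in> C" "t *\<^sub>R b \<in> C"
      using that C by (auto intro: mem_cone)
    with that have "s *\<^sub>R a \<in> cone hull {x}"
      using sum by (auto simp: mem_cone_hull_singleton)
    from mem_cone[OF cone_cone_hull this, of "1/s"] have "(1/s) *\<^sub>R (s *\<^sub>R a) \<in> cone hull {x}"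
      using that by simp
    then show ?thesis using that by simp
  qed
  have "cone hull {x} face_of C"
    unfolding face_of_def
  proof (intro conjI ballI impI)
    show "cone hull {x} \<subseteq> C"
      using x C by (simp add: hull_minimal)
    show "convex (cone hull {x})"
      by (simp add: convex_cone_hull)
  next
    fix a b y
    assume ab: "a \<in> C" "b \<in> C" and y: "y \<in> cone hull {x}" "y \<in> open_segment a b"
    then obtain u where u: "0 < u" "u < 1" "y = (1 - u) *\<^sub>R a + u *\<^sub>R b"
      by (auto simp: in_segment)
    show "a \<in> cone hull {x}"
      using summand[of a b "1 - u" u] ab y u by simp
    show "b \<in> cone hull {x}"
      using summand[of b a u "1 - u"] ab y u by (simp add: add.commute)
  qed
  with x show ?thesis by (simp add: extreme_ray_def)
qed

text \<open>If \<open>S\<close> were not in \<open>R\<close>, deleting the nonzero points of its ray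
  from the hull would leave a convex set that still contains \<open>R\<close>, against the
  minimality of the hull.\<close>

lemma extreme_ray_generator:
  assumes R: "cone R" and S: "extreme_ray S (convex hull R)"
  shows "S \<in> R"
proof (rule ccontr)
  assume "S \<notin> R"
  let ?F = "cone hull {S}" and ?H = "convex hull R"
  have F: "?F face_of ?H" and "S \<noteq> 0"
    using S by (auto simp: extreme_ray_def)
  have SF: "S \<in> ?F"
    by (simp add: hull_inc)
  have coneH: "cone ?H"
    using R by (rule cone_convex_hull)
  let ?K = "insert 0 (?H - ?F)"
  have scale: "c *\<^sub>R x \<in> ?K" if "x \<in> ?K" "0 \<le> c" for c x
  proof (cases "c = 0 \<or> x = 0")
    case False
    have "x \<in> ?F" if "c *\<^sub>R x \<in> ?F"
    proof -
      have "(1/c) *\<^sub>R (c *\<^sub>R x) \<in> ?F"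
        by (rule mem_cone[OF cone_cone_hull that]) (simp add: \<open>0 \<le> c\<close>)
      then show ?thesis using False by simp
    qed
    moreover have "c *\<^sub>R x \<in> ?H"
      using coneH that False by (intro mem_cone) auto
    ultimately show ?thesis using that False by blast
  qed auto
  \<comment> \<open>Were the sum on the ray, the face property would put the summand
    \<open>x\<close> there too.\<close>
  have add: "x + y \<in> ?K" if "x \<in> ?K" "y \<in> ?K" for x y
  proof (cases "x = 0 \<or> y = 0")
    case False
    then have xy: "x \<in> ?H" "y \<in> ?H" "x \<notin> ?F" using that by auto
    then have "x + y \<in> ?H"
      using coneH convex_convex_hull[of R] by (metis convex_cone)
    then show ?thesis
      using face_of_cone_summand[OF F cone_cone_hull coneH xy(1,2)] xy(3) by blast
  qed (use that in auto)
  have "convex ?K"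
    by (intro convexI add scale)
  moreover have "R \<subseteq> ?K"
  proof
    fix x assume x: "x \<in> R"
    \<comment> \<open>A nonzero point of \<open>R\<close> on the ray is a positive multiple of
      \<open>S\<close>, and scaling it back would put \<open>S\<close> into the cone
      \<open>R\<close>.\<close>
    have "x = 0" if xF: "x \<in> ?F"
    proof (rule ccontr)
      assume "x \<noteq> 0"
      obtain c where c: "0 \<le> c" "x = c *\<^sub>R S"
        using xF by (auto simp: mem_cone_hull_singleton)
      have "(1/c) *\<^sub>R x \<in> R"
        using R x c(1) by (intro mem_cone) auto
      then show False
        using c \<open>x \<noteq> 0\<close> \<open>S \<notin> R\<close> by auto
    qed
    then show "x \<in> ?K" using x by (auto intro: hull_inc)
  qed
  ultimately have "?H \<subseteq> ?K"
    by (simp add: hull_minimal)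
  moreover have "S \<in> ?H"
    using F SF face_of_imp_subset by blast
  ultimately show False
    using SF \<open>S \<noteq> 0\<close> by blast
qed

text \<open>Move from \<open>x\<close> along \<open>d\<close> until the first decreasing functional
  reaches zero. Functionals that vanish at \<open>x\<close> stay zero, and the decrease of
  \<open>f j\<close> guarantees that the motion is stopped.\<close>

lemma ratio_test:
  fixes f :: "'k \<Rightarrow> 'a::real_vector \<Rightarrow> real"
  assumes K: "finite K" and lin: "\<And>k. k \<in> K \<Longrightarrow> linear (f k)"
    and x: "\<And>k. k \<in> K \<Longrightarrow> 0 \<le> f k x"
    and tight: "\<And>k. \<lbrakk>k \<in> K; f k x = 0\<rbrakk> \<Longrightarrow> f k d = 0"
    and neg: "j \<in> K" "f j d < 0"
  obtains t where "\<And>k. k \<in> K \<Longrightarrow> 0 \<le> f k (x + t *\<^sub>R d)"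
    and "{k \<in> K. f k x = 0} \<subset> {k \<in> K. f k (x + t *\<^sub>R d) = 0}"
proof -
  have step: "f k (x + t *\<^sub>R d) = f k x + t * f k d" if "k \<in> K" for k t
    using lin[OF that] by (simp add: linear_add linear_scale)
  \<comment> \<open>For \<open>k\<close> in \<open>?J\<close>, the step length at which
    \<open>f k\<close> reaches zero; the least one is attained at \<open>i\<close>.\<close>
  let ?r = "\<lambda>k. f k x / - f k d" and ?J = "{k \<in> K. f k d < 0}"
  obtain i where i: "i \<in> ?J" "\<And>k. k \<in> ?J \<Longrightarrow> ?r i \<le> ?r k"
    using K neg by (intro that[of "arg_min_on ?r ?J"] arg_min_if_finite arg_min_least) auto
  let ?t = "?r i"
  have t: "0 \<le> ?t"
    using x i by (simp add: divide_nonneg_neg)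
  show thesis
  proof
    fix k assume k: "k \<in> K"
    show "0 \<le> f k (x + ?t *\<^sub>R d)"
    proof (cases "f k d < 0")
      case True
      then have "?t * - f k d \<le> f k x"
        using i(2)[of k] k by (subst pos_le_divide_eq [symmetric]) auto
      then show ?thesis using step[OF k, of ?t] by linarith
    next
      case False
      then have "0 \<le> ?t * f k d" using t by (intro mult_nonneg_nonneg) auto
      then show ?thesis using step[OF k, of ?t] x[OF k] by linarith
    qed
  next
    have "f i (x + ?t *\<^sub>R d) = 0"
      using i step[of i ?t] by simp
    \<comment> \<open>This makes the inclusion strict: were \<open>i\<close> tight at
      \<open>x\<close>, it would be constant along \<open>d\<close>.\<close>
    moreover have "f i x \<noteq> 0"
      using i tight by force
    moreover have "f k (x + ?t *\<^sub>R d) = 0" if "k \<in> K" "f k x = 0" for k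
      using step[of k ?t] tight that by simp
    ultimately show "{k \<in> K. f k x = 0} \<subset> {k \<in> K. f k (x + ?t *\<^sub>R d) = 0}"
      using i by blast
  qed
qed

section \<open>Slack form of \<open>P_cone\<close> and of realization\<close>

definition constraints :: "nat \<Rightarrow> nat \<Rightarrow> (nat set + nat \<times> nat) set" where
  "constraints N n = Inl ` {W. W \<subseteq> {1..N - 1} \<and> W \<inter> {1..n} \<noteq> {}} \<union> Inr ` edges N"

text \<open>Cut inequalities and sign conditions become one family of linear functionals required to
  be nonnegative, so that tightness and the ratio test treat them alike. A cut inequality is indexed
  by \<open>W\<close> alone, which determines \<open>I\<close>.\<close>

primrec slack ::
  "nat \<Rightarrow> nat \<Rightarrow> nat set + nat \<times> nat \<Rightarrow> (nat set \<Rightarrow>\<^sub>0 real) \<times> (nat \<times> nat \<Rightarrow>\<^sub>0 real) \<Rightarrow> real" where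
  "slack N n (Inl W) = (\<lambda>x. cut_weight N (snd x) W - Poly_Mapping.lookup (fst x) (W \<inter> {1..n}))"
| "slack N n (Inr e) = (\<lambda>x. Poly_Mapping.lookup (snd x) e)"

lemma lookup_scaleR: "Poly_Mapping.lookup (c *\<^sub>R v) i = c * Poly_Mapping.lookup v i"
proof -
  have "finite {i. c * Poly_Mapping.lookup v i \<noteq> 0}"
    by (rule finite_subset[OF _ finite_keys[of v]]) (auto simp: in_keys_iff)
  then show ?thesis
    by (simp add: scaleR_poly_mapping_def Abs_poly_mapping_inverse)
qed

lemma finite_edges: "finite (edges N)"
  by (rule finite_subset[of _ "{1..N} \<times> {1..N}"]) (auto simp: edges_def)

lemma finite_constraints: "finite (constraints N n)"
  by (simp add: constraints_def finite_edges)

lemma linear_slack: "linear (slack N n k)"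
  by (cases k) (auto intro!: linearI
      simp: cut_weight_def lookup_add lookup_scaleR sum.distrib sum_distrib_left algebra_simps)

lemma coord_space_iff: "v \<in> coord_space A \<longleftrightarrow> (\<forall>i. i \<notin> A \<longrightarrow> Poly_Mapping.lookup v i = 0)"
  by (auto simp: coord_space_def in_keys_iff)

lemma subspace_coord_space: "subspace (coord_space A)"
  by (auto simp: subspace_def coord_space_iff lookup_add lookup_scaleR)

lemma P_cone_iff:
  "x \<in> P_cone N n \<longleftrightarrow> fst x \<in> coord_space (terminal_sets n) \<and> snd x \<in> coord_space (edges N) \<and>
     (\<forall>k\<in>constraints N n. 0 \<le> slack N n k x)"
  by (cases x) (auto simp: P_cone_def constraints_def terminal_sets_def ball_Un)

lemma cone_P_cone: "cone (P_cone N n)"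
  by (auto simp: cone_def P_cone_iff linear_scale[OF linear_slack] subspace_scale[OF subspace_coord_space])

text \<open>Being the minimum of a finite nonempty set means being a lower bound that is attained:
  membership in \<open>P_cone\<close> plus a tight cut for every \<open>I\<close>. The bound on
  \<open>N\<close> makes \<open>I\<close> itself an admissible \<open>W\<close>.\<close>

lemma realizes_iff:
  assumes "n + 1 \<le> N"
  shows "realizes N n w S \<longleftrightarrow> (S, w) \<in> P_cone N n \<and>
    (\<forall>I\<in>terminal_sets n. \<exists>W. W \<subseteq> {1..N - 1} \<and> W \<inter> {1..n} = I \<and> slack N n (Inl W) (S, w) = 0)"
proof -
  let ?C = "\<lambda>I. {cut_weight N w W |W. W \<subseteq> {1..N - 1} \<and> W \<inter> {1..n} = I}"
  have Min: "Poly_Mapping.lookup S I = Min (?C I) \<longleftrightarrow>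
      (\<forall>W. W \<subseteq> {1..N - 1} \<longrightarrow> I = W \<inter> {1..n} \<longrightarrow> Poly_Mapping.lookup S I \<le> cut_weight N w W) \<and>
      (\<exists>W. W \<subseteq> {1..N - 1} \<and> W \<inter> {1..n} = I \<and> slack N n (Inl W) (S, w) = 0)"
    if "I \<in> terminal_sets n" for I
  proof -
    have fin: "finite (?C I)"
      by (rule finite_subset[of _ "cut_weight N w ` Pow {1..N - 1}"]) auto
    have "I \<subseteq> {1..N - 1}" "I \<inter> {1..n} = I"
      using that assms by (auto simp: terminal_sets_def)
    then have "?C I \<noteq> {}" by blast
    then have Min: "Poly_Mapping.lookup S I = Min (?C I) \<longleftrightarrow>
        Poly_Mapping.lookup S I \<in> ?C I \<and> (\<forall>c\<in>?C I. Poly_Mapping.lookup S I \<le> c)"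
      by (rule eq_Min_iff[OF fin])
    have "slack N n (Inl W) (S, w) = 0 \<longleftrightarrow> Poly_Mapping.lookup S I = cut_weight N w W"
      if "W \<inter> {1..n} = I" for W
      using that by auto
    then show ?thesis
      unfolding Min by blast
  qed
  have Min_all: "(\<forall>I\<in>terminal_sets n. Poly_Mapping.lookup S I = Min (?C I)) \<longleftrightarrow>
      (\<forall>W I. W \<subseteq> {1..N - 1} \<longrightarrow> I \<in> terminal_sets n \<longrightarrow> I = W \<inter> {1..n} \<longrightarrow>
         Poly_Mapping.lookup S I \<le> cut_weight N w W) \<and>
      (\<forall>I\<in>terminal_sets n. \<exists>W. W \<subseteq> {1..N - 1} \<and> W \<inter> {1..n} = I \<and> slack N n (Inl W) (S, w) = 0)"
    by (subst ball_cong[OF refl Min]) blast+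
  show ?thesis
    unfolding realizes_def P_cone_def mem_Collect_eq case_prod_conv Min_all by (simp only: conj_ac)
qed

lemma cone_realized:
  assumes "n + 1 \<le> N"
  shows "cone {S. \<exists>w. realizes N n w S}"
proof -
  have "realizes N n (c *\<^sub>R w) (c *\<^sub>R S)" if w: "realizes N n w S" and c: "0 \<le> c" for c w S
    unfolding realizes_iff[OF assms]
  proof (intro conjI ballI)
    show "(c *\<^sub>R S, c *\<^sub>R w) \<in> P_cone N n"
      using mem_cone[OF cone_P_cone, of "(S, w)" N n c] w c by (simp add: realizes_iff[OF assms])
    fix I assume "I \<in> terminal_sets n"
    then obtain W where W: "W \<subseteq> {1..N - 1}" "W \<inter> {1..n} = I" "slack N n (Inl W) (S, w) = 0"
      using w unfolding realizes_iff[OF assms] by blast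
    have "slack N n (Inl W) (c *\<^sub>R S, c *\<^sub>R w) = c * slack N n (Inl W) (S, w)"
      using linear_scale[OF linear_slack, of N n "Inl W" c "(S, w)"] by simp
    with W show "\<exists>W. W \<subseteq> {1..N - 1} \<and> W \<inter> {1..n} = I \<and> slack N n (Inl W) (c *\<^sub>R S, c *\<^sub>R w) = 0"
      by (intro exI[of _ W]) simp
  qed
  then show ?thesis unfolding cone_def by blast
qed

section \<open>From non-trivial extreme rays to realizations\<close>

lemma nontrivial_extreme_ray_realizes:
  assumes N: "n + 1 \<le> N" and ray: "nontrivial_extreme_ray N n (S, w)"
  shows "realizes N n w S"
proof (rule ccontr)
  assume not: "\<not> realizes N n w S"
  have F: "cone hull {(S, w)} face_of P_cone N n" and nt: "\<not> trivial_ray N n (S, w)"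
    using ray by (auto simp: nontrivial_extreme_ray_def extreme_ray_def)
  then have P: "(S, w) \<in> P_cone N n"
    using face_of_imp_subset hull_subset[of "{(S, w)}" cone] by blast
  with not obtain I where I: "I \<in> terminal_sets n"
    and slack: "\<And>W. \<lbrakk>W \<subseteq> {1..N - 1}; W \<inter> {1..n} = I\<rbrakk> \<Longrightarrow> slack N n (Inl W) (S, w) \<noteq> 0"
    by (auto simp: realizes_iff[OF N])
  let ?A = "{W. W \<subseteq> {1..N - 1} \<and> W \<inter> {1..n} = I}"
  have I0: "I \<noteq> {}" using I by (simp add: terminal_sets_def)
  have pos: "0 < slack N n (Inl W) (S, w)" if "W \<in> ?A" for W
  proof -
    have "Inl W \<in> constraints N n"
      using that I0 by (simp add: constraints_def)
    then have "0 \<le> slack N n (Inl W) (S, w)"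
      using P by (simp only: P_cone_iff)
    with slack[of W] that show ?thesis by simp
  qed
  \<comment> \<open>An amount by which the coordinate \<open>I\<close> of \<open>S\<close> can be
    raised within all cut inequalities for \<open>I\<close>. The entry \<open>1\<close> makes the
    set visibly nonempty.\<close>
  define \<delta> where "\<delta> = Min (insert 1 ((\<lambda>W. slack N n (Inl W) (S, w)) ` ?A))"
  have \<delta>: "0 < \<delta>" "\<And>W. W \<in> ?A \<Longrightarrow> \<delta> \<le> slack N n (Inl W) (S, w)"
    using pos by (auto simp: \<delta>_def)
  let ?a = "\<delta> *\<^sub>R (Poly_Mapping.single I (- 1), 0) :: (nat set \<Rightarrow>\<^sub>0 real) \<times> (nat \<times> nat \<Rightarrow>\<^sub>0 real)"
  have coord: "Poly_Mapping.single I (- 1) \<in> coord_space (terminal_sets n)"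
    using I by (simp add: coord_space_def)
  have slack_a: "slack N n k ?a = (case k of Inl W \<Rightarrow> (if W \<inter> {1..n} = I then \<delta> else 0) | Inr e \<Rightarrow> 0)" for k
    by (cases k) (auto simp: cut_weight_def lookup_single when_def lookup_scaleR)
  have a: "?a \<in> P_cone N n"
    unfolding P_cone_iff slack_a using coord \<delta>(1)
    by (auto simp: subspace_0 subspace_scale subspace_coord_space split: sum.split)
  have b: "(S, w) - ?a \<in> P_cone N n"
    unfolding P_cone_iff
  proof (intro conjI ballI)
    show "fst ((S, w) - ?a) \<in> coord_space (terminal_sets n)" "snd ((S, w) - ?a) \<in> coord_space (edges N)"
      using P coord by (auto simp: P_cone_iff intro!: subspace_diff subspace_scale subspace_coord_space)
    fix k assume k: "k \<in> constraints N n"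
    then have "0 \<le> slack N n k (S, w)" using P by (auto simp: P_cone_iff)
    moreover have "slack N n k (S, w) \<ge> \<delta>" if "k = Inl W" "W \<inter> {1..n} = I" for W
      using k \<delta>(2)[of W] that by (auto simp: constraints_def)
    ultimately show "0 \<le> slack N n k ((S, w) - ?a)"
      unfolding linear_diff[OF linear_slack] slack_a by (cases k) auto
  qed
  \<comment> \<open>Subtracting \<open>?a\<close> raises the coordinate \<open>I\<close>, so
    \<open>(S, w)\<close> is a sum of two members of \<open>P_cone\<close>. Since \<open>?a\<close>
    is nonzero and on the ray, it generates the ray.\<close>
  have "?a \<in> cone hull {(S, w)}"
    by (rule face_of_cone_summand[OF F cone_cone_hull cone_P_cone a b]) (simp add: hull_inc)
  then obtain c where c: "0 \<le> c" "?a = c *\<^sub>R (S, w)"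
    by (auto simp: mem_cone_hull_singleton)
  have "Poly_Mapping.lookup (fst ?a) I \<noteq> 0"
    using \<delta>(1) by (simp add: lookup_scaleR)
  then have "?a \<noteq> 0" by (metis fst_zero lookup_zero)
  with c have "0 < c" by (metis order_le_less scaleR_zero_left)
  then have "(S, w) = (1/c) *\<^sub>R ?a" unfolding c(2) by simp
  also have "\<dots> = (\<delta> / c) *\<^sub>R (Poly_Mapping.single I (- 1), 0)" by simp
  finally have "trivial_ray N n (S, w)"
    unfolding trivial_ray_def using I \<delta>(1) \<open>0 < c\<close> divide_pos_pos by blast
  with nt show False ..
qed

section \<open>Lifting extreme rays of \<open>H_cone\<close> to \<open>P_cone\<close>\<close>

lemma extreme_ray_lift:
  assumes N: "n + 1 \<le> N" and ray: "extreme_ray S (H_cone N n)"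
  shows "\<exists>w. nontrivial_extreme_ray N n (S, w)"
proof -
  let ?K = "constraints N n"
  let ?T = "\<lambda>w. {k \<in> ?K. slack N n k (S, w) = 0}"
  have S0: "S \<noteq> 0" and F: "cone hull {S} face_of H_cone N n"
    using ray by (auto simp: extreme_ray_def)
  obtain w0 where w0: "realizes N n w0 S"
    using extreme_ray_generator[OF cone_realized[OF N]] ray by (auto simp: H_cone_def)
  have bound: "card (?T w) \<le> card ?K" for w
    by (intro card_mono finite_constraints) auto
  have "\<exists>w. realizes N n w S \<and> (\<forall>v. realizes N n v S \<longrightarrow> card (?T v) \<le> card (?T w))"
    by (rule ex_has_greatest_nat[where P = "\<lambda>w. realizes N n w S" and f = "\<lambda>w. card (?T w)"
          and b = "Suc (card ?K)", OF w0]) (use bound le_imp_less_Suc in blast)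
  then obtain w where w: "realizes N n w S"
    and max: "\<And>v. realizes N n v S \<Longrightarrow> card (?T v) \<le> card (?T w)"
    by blast
  have wP: "(S, w) \<in> P_cone N n" using w by (simp add: realizes_iff[OF N])
  \<comment> \<open>The tight cuts of \<open>(S, w)\<close> include one for every \<open>I\<close>,
    so preserving them preserves attainment of all the minima.\<close>
  have transfer: "realizes N n v U"
    if "(U, v) \<in> P_cone N n" "\<And>k. k \<in> ?T w \<Longrightarrow> slack N n k (U, v) = 0" for U v
    unfolding realizes_iff[OF N]
  proof (intro conjI ballI that(1))
    fix I assume I: "I \<in> terminal_sets n"
    then obtain W where W: "W \<subseteq> {1..N - 1}" "W \<inter> {1..n} = I" "slack N n (Inl W) (S, w) = 0"
      using w unfolding realizes_iff[OF N] by blast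
    then have "Inl W \<in> ?T w"
      using I by (auto simp: constraints_def terminal_sets_def)
    then show "\<exists>W. W \<subseteq> {1..N - 1} \<and> W \<inter> {1..n} = I \<and> slack N n (Inl W) (U, v) = 0"
      using W that(2) by blast
  qed
  \<comment> \<open>Otherwise the ratio test along \<open>(0, d)\<close>, stopped at the latest by
    the sign condition of \<open>e\<close>, yields a realization of the same \<open>S\<close> with
    more tight constraints than the maximal \<open>w\<close>.\<close>
  have rigid: "\<not> Poly_Mapping.lookup d e < 0"
    if d: "d \<in> coord_space (edges N)" "\<And>k. k \<in> ?T w \<Longrightarrow> slack N n k (0, d) = 0" and e: "e \<in> edges N"
    for d e
  proof
    assume neg: "Poly_Mapping.lookup d e < 0"
    obtain t where t: "\<And>k. k \<in> ?K \<Longrightarrow> 0 \<le> slack N n k ((S, w) + t *\<^sub>R (0, d))"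
      "?T w \<subset> {k \<in> ?K. slack N n k ((S, w) + t *\<^sub>R (0, d)) = 0}"
    proof (rule ratio_test[OF finite_constraints linear_slack])
      show "0 \<le> slack N n k (S, w)" if "k \<in> ?K" for k using wP that by (simp add: P_cone_iff)
      show "slack N n k (0, d) = 0" if "k \<in> ?K" "slack N n k (S, w) = 0" for k using d that by simp
      show "Inr e \<in> ?K" using e by (simp add: constraints_def)
      show "slack N n (Inr e) (0, d) < 0" using neg by simp
    qed blast
    have shift: "(S, w) + t *\<^sub>R (0, d) = (S, w + t *\<^sub>R d)" by simp
    have "realizes N n (w + t *\<^sub>R d) S"
    proof (rule transfer)
      show "(S, w + t *\<^sub>R d) \<in> P_cone N n"
        using t(1) wP d(1) unfolding shift P_cone_iff
        by (auto intro!: subspace_add subspace_scale subspace_coord_space)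
    qed (use t(2) shift in auto)
    then have "card (?T (w + t *\<^sub>R d)) \<le> card (?T w)" by (rule max)
    moreover have "card (?T w) < card (?T (w + t *\<^sub>R d))"
      using t(2) unfolding shift by (intro psubset_card_mono) (simp_all add: finite_constraints)
    ultimately show False by simp
  qed
  have "extreme_ray (S, w) (P_cone N n)"
  proof (rule extreme_rayI[OF _ wP cone_P_cone])
    show "(S, w) \<noteq> 0" using S0 by (simp add: zero_prod_def)
  next
    fix a b and k :: real
    assume a: "a \<in> P_cone N n" and b: "b \<in> P_cone N n" and k: "0 \<le> k" and ab: "a + b = k *\<^sub>R (S, w)"
    \<comment> \<open>Two nonnegative slacks add up to \<open>k\<close> times a zero slack.\<close>
    have tight: "slack N n j a = 0 \<and> slack N n j b = 0" if "j \<in> ?T w" for j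
    proof -
      have "slack N n j a + slack N n j b = k * slack N n j (S, w)"
        using arg_cong[OF ab, of "slack N n j"]
        by (simp only: linear_add[OF linear_slack] linear_scale[OF linear_slack] real_scaleR_def)
      moreover have "0 \<le> slack N n j a" "0 \<le> slack N n j b"
        using a b that by (auto simp: P_cone_iff)
      ultimately show ?thesis using that by auto
    qed
    have "realizes N n (snd a) (fst a)" "realizes N n (snd b) (fst b)"
      using a b tight by (auto intro!: transfer)
    then have "fst a \<in> H_cone N n" "fst b \<in> H_cone N n"
      by (auto simp: H_cone_def intro!: hull_inc)
    moreover have "fst a + fst b \<in> cone hull {S}"
      using arg_cong[OF ab, of fst] k by (auto simp: mem_cone_hull_singleton)
    moreover have "cone (H_cone N n)"
      unfolding H_cone_def by (intro cone_convex_hull cone_realized N)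
    ultimately have "fst a \<in> cone hull {S}"
      using face_of_cone_summand[OF F cone_cone_hull] by blast
    then obtain c where c: "0 \<le> c" "fst a = c *\<^sub>R S"
      by (auto simp: mem_cone_hull_singleton)
    \<comment> \<open>The deviation of \<open>snd a\<close> from the multiple of \<open>w\<close>
      dictated by \<open>fst a\<close>. Applying \<open>rigid\<close> to both \<open>d\<close> and
      \<open>- d\<close> forces it to vanish.\<close>
    define d where "d = snd a - c *\<^sub>R w"
    have d: "d \<in> coord_space (edges N)" "- d \<in> coord_space (edges N)"
      using a wP by (auto simp: d_def P_cone_iff intro!: subspace_diff subspace_scale subspace_coord_space)
    have ad: "a - c *\<^sub>R (S, w) = (0, d)"
      using c by (simp add: d_def prod_eq_iff)
    have td: "slack N n j (0, d) = 0" if "j \<in> ?T w" for j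
      using tight[OF that] that unfolding ad[symmetric]
      by (simp add: linear_diff[OF linear_slack] linear_scale[OF linear_slack] del: scaleR_Pair)
    have "(0, - d) = - (0::nat set \<Rightarrow>\<^sub>0 real, d)" by simp
    then have td': "slack N n j (0, - d) = 0" if "j \<in> ?T w" for j
      using td[OF that] by (simp only: linear_neg[OF linear_slack])
    have "Poly_Mapping.lookup d e = 0" if "e \<in> edges N" for e
      using rigid[OF d(1) td that] rigid[OF d(2) td' that] by simp
    moreover have "Poly_Mapping.lookup d e = 0" if "e \<notin> edges N" for e
      using d(1) that by (auto simp: coord_space_def in_keys_iff)
    ultimately have "d = 0" by (intro poly_mapping_eqI) auto
    then have "a = c *\<^sub>R (S, w)" using ad by (simp add: zero_prod_def[symmetric])
    with c show "a \<in> cone hull {(S, w)}" by (auto simp: mem_cone_hull_singleton)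
  qed
  \<comment> \<open>A trivial edge ray has \<open>S = 0\<close>. For the other kind
    \<open>w = 0\<close>, so all cuts weigh zero, and the tight cut for \<open>I\<close> contradicts
    the negative coordinate \<open>- c\<close>.\<close>
  moreover have "\<not> trivial_ray N n (S, w)"
  proof
    assume "trivial_ray N n (S, w)"
    then obtain c I where c: "0 < c" and I: "I \<in> terminal_sets n"
      and eq: "S = c *\<^sub>R Poly_Mapping.single I (- 1)" "w = 0"
      using S0 by (auto simp: trivial_ray_def)
    obtain W where "slack N n (Inl W) (S, w) = 0" "W \<inter> {1..n} = I"
      using w I unfolding realizes_iff[OF N] by blast
    then show False
      using c by (simp add: eq cut_weight_def lookup_scaleR)
  qed
  ultimately show ?thesis by (auto simp: nontrivial_extreme_ray_def)
qed

theorem theorem2: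
  fixes n N :: nat
  assumes "3 \<le> n + 1" and "n + 1 \<le> N"
  shows "(\<forall>S w. nontrivial_extreme_ray N n (S, w) \<longrightarrow> S \<in> H_cone N n) \<and>
         (\<forall>S. extreme_ray S (H_cone N n) \<longrightarrow> (\<exists>w. nontrivial_extreme_ray N n (S, w)))"
proof (intro conjI allI impI)
  fix S w assume "nontrivial_extreme_ray N n (S, w)"
  then have "realizes N n w S"
    by (rule nontrivial_extreme_ray_realizes[OF assms(2)])
  then show "S \<in> H_cone N n"
    by (auto simp: H_cone_def intro!: hull_inc)
next
  fix S assume "extreme_ray S (H_cone N n)"
  then show "\<exists>w. nontrivial_extreme_ray N n (S, w)"
    by (rule extreme_ray_lift[OF assms(2)])
qed

end
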